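(* Let $\Phi(z)=1+B_1z+B_2z^2+B_3z^3+\cdots$ be analytic and univalent in $\mathbb{D}=\{z\in\mathbb{C}:|z|<1\}$, such that $\Phi(\mathbb{D})$ is symmetric with respect to the real axis and starlike with respect to $\Phi(0)=1$, and $\Phi'(0)=B_1>0$. Let $f(z)=z+\sum_{n=2}^{\infty}a_nz^n$ belong to the Ma--Minda convex class $\mathcal{C}(\Phi)$, and let $f^{-1}(z)=z+\sum_{n=2}^{\infty}A_nz^n$ be the Taylor expansion at $0$ of its inverse function. Then $$|A_3|-|A_2|\le \begin{cases}\dfrac{|2B_1^2-B_2|-3B_1}{6}, & \text{if } |2B_1^2-B_2|\ge 4B_1,\\[6pt] \dfrac{B_1}{6}, & \text{if } |2B_1^2-B_2|<4B_1,\end{cases}$$ and $$|A_3|-|A_2|\ge \begin{cases}\dfrac{|2B_1^2-B_2|-3B_1}{6}, & \text{if } B_1\ge |4B_1^2-2B_2|,\\[6pt] -\dfrac{B_1}{2}\sqrt{\dfrac{B_1}{B_1+|2B_1^2-B_2|}}, & \text{if } 5B_1\le |8B_1^2-4B_2|,\\[6pt] -\dfrac{B_1}{6}-\dfrac{3B_1^2}{8|2B_1^2-B_2|+8B_1}, & \text{otherwise.}\end{cases}$$ All of these bounds are sharp: for every such $\Phi$, each of the two applicable bounds is attained with equality by some $f\in\mathcal{C}(\Phi)$.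
   Context: $\mathcal{A}$ denotes the class of functions $f$ analytic in $\mathbb{D}$ with $f(0)=0$, $f'(0)=1$, i.e. $f(z)=z+\sum_{n\ge2}a_nz^n$. For analytic $g,h$ on $\mathbb{D}$, $g$ is subordinate to $h$, written $g\prec h$, if there is an analytic $\omega:\mathbb{D}\to\mathbb{D}$ with $\omega(0)=0$ such that $g(z)=h(\omega(z))$ for all $z\in\mathbb{D}$. For $\Phi$ as in the statement, the Ma--Minda convex class $\mathcal{C}(\Phi)$ is the set of all $f\in\mathcal{A}$ such that $1+\dfrac{zf''(z)}{f'(z)}\prec\Phi(z)$ in $\mathbb{D}$. The inverse $f^{-1}$ is the inverse of $f$ near the origin, satisfying $f(f^{-1}(z))=z$ near $0$; its initial coefficients are $A_2=-a_2$ and $A_3=2a_2^2-a_3$. *)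

theory Defs
  imports "HOL-Complex_Analysis.Complex_Analysis"
begin

abbreviation unit_disc :: "complex set" ("\<D>")
  where "\<D> \<equiv> ball 0 1"

abbreviation taylor_coeff :: "(complex \<Rightarrow> complex) \<Rightarrow> nat \<Rightarrow> complex"
  where "taylor_coeff g n \<equiv> fps_nth (fps_expansion g 0) n"

definition symmetric_real_axis :: "complex set \<Rightarrow> bool"
  where "symmetric_real_axis S \<longleftrightarrow> cnj ` S = S"

text \<open>The library predicate \<^const>\<open>starlike\<close> leaves the centre existentially quantified;
  here it is prescribed.\<close>

definition starlike_wrt :: "complex \<Rightarrow> complex set \<Rightarrow> bool"
  where "starlike_wrt a S \<longleftrightarrow> a \<in> S \<and> (\<forall>x\<in>S. closed_segment a x \<subseteq> S)"

definition class_A :: "(complex \<Rightarrow> complex) set"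
  where "class_A = {f. f holomorphic_on \<D> \<and> f 0 = 0 \<and> deriv f 0 = 1}"

text \<open>Subordination is a relation between analytic functions, so the analyticity of both
  sides is part of it.\<close>

definition subordinate :: "(complex \<Rightarrow> complex) \<Rightarrow> (complex \<Rightarrow> complex) \<Rightarrow> bool"
    (infix "\<prec>" 50)
  where "g \<prec> h \<longleftrightarrow> g holomorphic_on \<D> \<and> h holomorphic_on \<D> \<and>
    (\<exists>\<omega>. \<omega> holomorphic_on \<D> \<and> \<omega> ` \<D> \<subseteq> \<D> \<and> \<omega> 0 = 0 \<and> (\<forall>z\<in>\<D>. g z = h (\<omega> z)))"

text \<open>That \<open>f'\<close> has no zero in the disc is what makes \<open>1 + z f''(z) / f'(z)\<close> an analytic
  function there; it is stated explicitly because division by zero is total.\<close>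

definition Ma_Minda_convex :: "(complex \<Rightarrow> complex) \<Rightarrow> (complex \<Rightarrow> complex) set"
  where "Ma_Minda_convex \<Phi> = {f \<in> class_A. (\<forall>z\<in>\<D>. deriv f z \<noteq> 0) \<and>
    (\<lambda>z. 1 + z * deriv (deriv f) z / deriv f z) \<prec> \<Phi>}"

text \<open>\<open>g\<close> represents the germ at the origin of \<open>f\<^sup>-\<^sup>1\<close>.\<close>

definition inverse_near_0 :: "(complex \<Rightarrow> complex) \<Rightarrow> (complex \<Rightarrow> complex) \<Rightarrow> bool"
  where "inverse_near_0 f g \<longleftrightarrow> g analytic_on {0} \<and> g 0 = 0 \<and> (\<forall>\<^sub>F z in nhds 0. f (g z) = z)"

lemma inverse_near_0_exists:
  assumes "f \<in> class_A"
  shows "\<exists>g. inverse_near_0 f g"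
proof -
  have hol: "f holomorphic_on \<D>" and f0: "f 0 = 0" and "deriv f 0 \<noteq> 0"
    using assms by (auto simp: class_A_def)
  then obtain r where r: "r > 0" "ball 0 r \<subseteq> \<D>" "open (f ` ball 0 r)" "inj_on f (ball 0 r)"
    using has_complex_derivative_locally_invertible[OF hol, of 0] by auto
  have "f holomorphic_on ball 0 r"
    using hol r(2) holomorphic_on_subset by blast
  then obtain g where g: "g holomorphic_on f ` ball 0 r" "\<And>z. z \<in> ball 0 r \<Longrightarrow> g (f z) = z"
    using holomorphic_has_inverse[OF _ open_ball r(4)] by metis
  have 0: "0 \<in> f ` ball 0 r"
    using f0 r(1) by (metis centre_in_ball image_eqI)
  have "g analytic_on {0}"
    using g(1) r(3) 0 analytic_at by blast
  moreover have "g 0 = 0"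
    using g(2)[of 0] f0 r(1) by simp
  moreover have "\<forall>\<^sub>F z in nhds 0. f (g z) = z"
    by (rule eventually_mono[OF eventually_nhds_in_open[OF r(3) 0]]) (use g(2) in auto)
  ultimately show ?thesis
    unfolding inverse_near_0_def by blast
qed

text \<open>The bounds for \<open>|A\<^sub>3| - |A\<^sub>2|\<close>. Reality of \<open>B\<^sub>2\<close> is a consequence of the symmetry of
  the image of \<open>\<Phi>\<close>, not a hypothesis, so \<open>B\<^sub>2\<close> is complex here.\<close>

definition upper_bound :: "real \<Rightarrow> complex \<Rightarrow> real"
  where "upper_bound B1 B2 =
    (if cmod (2 * of_real B1 ^ 2 - B2) \<ge> 4 * B1
     then (cmod (2 * of_real B1 ^ 2 - B2) - 3 * B1) / 6
     else B1 / 6)"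

definition lower_bound :: "real \<Rightarrow> complex \<Rightarrow> real"
  where "lower_bound B1 B2 =
    (if B1 \<ge> cmod (4 * of_real B1 ^ 2 - 2 * B2)
     then (cmod (2 * of_real B1 ^ 2 - B2) - 3 * B1) / 6
     else if 5 * B1 \<le> cmod (8 * of_real B1 ^ 2 - 4 * B2)
     then - (B1 / 2) * sqrt (B1 / (B1 + cmod (2 * of_real B1 ^ 2 - B2)))
     else - B1 / 6 - 3 * B1 ^ 2 / (8 * cmod (2 * of_real B1 ^ 2 - B2) + 8 * B1))"

end

theory Submission
  imports Defs
begin

text \<open>
  Write \<open>1 + z f'' / f' = \<Phi> \<circ> \<omega>\<close> with \<open>\<omega> z = c\<^sub>1 z + c\<^sub>2 z\<^sup>2 + \<dots>\<close> a Schwarz function. Comparing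
  coefficients and inverting the power series of \<open>f\<close> gives
  \<open>A\<^sub>2 = - B\<^sub>1 c\<^sub>1 / 2\<close> and \<open>A\<^sub>3 = (M c\<^sub>1\<^sup>2 - B\<^sub>1 c\<^sub>2) / 6\<close> where \<open>M = 2 B\<^sub>1\<^sup>2 - B\<^sub>2\<close>
  (\<open>inverse_coeffs_of_subordinate\<close>). The pairs \<open>(c\<^sub>1, c\<^sub>2)\<close> that occur are exactly those with
  \<open>|c\<^sub>1| \<le> 1\<close> and \<open>|c\<^sub>2| \<le> 1 - |c\<^sub>1|\<^sup>2\<close>: necessity is the Schwarz--Pick inequality at the origin for
  \<open>\<omega> z / z\<close> (\<open>Schwarz_coeffs_bound\<close>), and a Moebius map of the disc gives sufficiency
  (\<open>Schwarz_coeffs_exist\<close>). Moreover every Schwarz function comes from some \<open>f\<close> in the class,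
  because \<open>z f'' / f' = \<Phi> \<circ> \<omega> - 1\<close> can be integrated twice (\<open>Ma_Minda_convex_of_Schwarz\<close>).

  With \<open>x = |c\<^sub>1|\<close> and \<open>m = |M|\<close>, the triangle inequality confines \<open>6 |A\<^sub>3|\<close> to the interval from
  \<open>max 0 (m x\<^sup>2 - B\<^sub>1 (1 - x\<^sup>2))\<close> to \<open>m x\<^sup>2 + B\<^sub>1 (1 - x\<^sup>2)\<close>, and \<open>|A\<^sub>2| = B\<^sub>1 x / 2\<close>. So the theorem
  is the optimisation of a piecewise quadratic function of \<open>x \<in> [0, 1]\<close>. The maximum is at an
  endpoint. The minimum is at \<open>x = 1\<close>, at the kink \<open>x\<^sup>2 = B\<^sub>1 / (B\<^sub>1 + m)\<close> where \<open>A\<^sub>3\<close> can be made to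
  vanish, or at the vertex \<open>x = 3 B\<^sub>1 / (2 (B\<^sub>1 + m))\<close> of the parabola; these are the three cases of
  the lower bound. At each optimal \<open>x\<close> the phase of \<open>c\<^sub>2\<close> can be chosen to give equality.
\<close>

section \<open>The first two coefficients of a Schwarz function\<close>

lemma taylor_coeff_1: "taylor_coeff g 1 = deriv g 0"
  by (simp add: fps_expansion_def)

lemma has_fps_expansion_disc:
  assumes "g holomorphic_on \<D>"
  shows "g has_fps_expansion fps_expansion g 0"
  by (rule has_fps_expansion_fps_expansion[OF open_ball _ assms]) simp

lemma eventually_disc_0: "\<forall>\<^sub>F z in nhds (0::complex). z \<in> \<D>"
  by (rule eventually_nhds_in_open) auto

lemma has_fps_expansion_transform:
  assumes "f has_fps_expansion F" and "\<forall>\<^sub>F z in nhds 0. f z = g z"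
  shows "g has_fps_expansion F"
  using has_fps_expansion_cong[OF assms(2) refl] assms(1) by blast

lemma fps_expansion_times_z:
  assumes "\<psi> holomorphic_on \<D>" and "\<And>z. z \<in> \<D> \<Longrightarrow> \<omega> z = z * \<psi> z"
  shows "fps_expansion \<omega> 0 = fps_X * fps_expansion \<psi> 0"
proof (rule fps_expansion_eqI)
  have "(\<lambda>z. z * \<psi> z) has_fps_expansion fps_X * fps_expansion \<psi> 0"
    by (intro fps_expansion_intros has_fps_expansion_disc assms)
  moreover have "\<forall>\<^sub>F z in nhds 0. z * \<psi> z = \<omega> z"
    using eventually_disc_0 by eventually_elim (use assms(2) in auto)
  ultimately show "\<omega> has_fps_expansion fps_X * fps_expansion \<psi> 0"
    by (rule has_fps_expansion_transform)
qed

lemma Moebius_function_has_field_derivative: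
  assumes "1 - cnj w * z \<noteq> 0"
  shows "(Moebius_function 0 w has_field_derivative
           of_real (1 - (cmod w)\<^sup>2) / (1 - cnj w * z)\<^sup>2) (at z)"
proof -
  have "((\<lambda>z. (z - w) / (1 - cnj w * z)) has_field_derivative
           (1 * (1 - cnj w * z) - (z - w) * (- cnj w)) / ((1 - cnj w * z) * (1 - cnj w * z)))
         (at z)"
    using assms by (intro DERIV_divide) (auto intro!: derivative_eq_intros)
  also have "1 * (1 - cnj w * z) - (z - w) * (- cnj w) = of_real (1 - (cmod w)\<^sup>2)"
    unfolding of_real_diff of_real_1 complex_norm_square by (simp add: algebra_simps)
  finally show ?thesis
    by (simp add: Moebius_function_def power2_eq_square)
qed

text \<open>Composing \<open>\<psi>\<close> with the Moebius map that sends \<open>\<psi> 0\<close> to \<open>0\<close> reduces this to the Schwarz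
  lemma, which bounds the derivative \<open>\<psi>'(0) / (1 - |\<psi> 0|\<^sup>2)\<close> of the composition.\<close>

lemma Schwarz_Pick_at_0:
  assumes hol: "\<psi> holomorphic_on \<D>" and le: "\<And>z. z \<in> \<D> \<Longrightarrow> cmod (\<psi> z) < 1"
  shows "cmod (deriv \<psi> 0) \<le> 1 - (cmod (\<psi> 0))\<^sup>2"
proof -
  define c where "c = \<psi> 0"
  have c: "cmod c < 1" using le[of 0] by (simp add: c_def)
  then have pos: "0 < 1 - (cmod c)\<^sup>2"
    by (simp add: power_less_one_iff abs_square_less_1)
  define \<phi> where "\<phi> = Moebius_function 0 c \<circ> \<psi>"
  have "\<phi> holomorphic_on \<D>"
    unfolding \<phi>_def
    by (rule holomorphic_on_compose_gen[OF hol Moebius_function_holomorphic[OF c]])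
       (use le in auto)
  moreover have "\<phi> 0 = 0"
    by (simp add: \<phi>_def c_def Moebius_function_eq_zero)
  moreover have "cmod (\<phi> z) < 1" if "cmod z < 1" for z
    using Moebius_function_norm_lt_1[OF c] le that by (simp add: \<phi>_def)
  ultimately have bound: "cmod (deriv \<phi> 0) \<le> 1"
    by (rule Schwarz_Lemma(2)[where \<xi> = 0]) auto
  have one: "1 - cnj c * c = of_real (1 - (cmod c)\<^sup>2)"
    unfolding of_real_diff of_real_1 complex_norm_square by (simp add: mult.commute)
  have "(\<psi> has_field_derivative deriv \<psi> 0) (at 0)"
    by (rule holomorphic_derivI[OF hol]) auto
  moreover have "1 - cnj c * c \<noteq> 0"
    unfolding one of_real_eq_0_iff using pos by linarith
  ultimately have "(\<phi> has_field_derivative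
      of_real (1 - (cmod c)\<^sup>2) / (1 - cnj c * c)\<^sup>2 * deriv \<psi> 0) (at 0)"
    unfolding \<phi>_def using Moebius_function_has_field_derivative[of c c]
    by (intro DERIV_chain) (auto simp: c_def)
  then have "deriv \<phi> 0 = of_real (1 - (cmod c)\<^sup>2) / (of_real (1 - (cmod c)\<^sup>2))\<^sup>2 * deriv \<psi> 0"
    unfolding one by (rule DERIV_imp_deriv)
  also have "\<dots> = deriv \<psi> 0 / of_real (1 - (cmod c)\<^sup>2)"
    by (simp only: power2_eq_square) simp
  finally have "cmod (deriv \<phi> 0) = cmod (deriv \<psi> 0) / (1 - (cmod c)\<^sup>2)"
    using pos by (simp only: norm_divide norm_of_real abs_of_pos)
  then show ?thesis
    using bound pos by (simp add: c_def pos_divide_le_eq)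
qed

lemma Schwarz_coeffs_bound:
  assumes hol: "\<omega> holomorphic_on \<D>" and maps: "\<omega> ` \<D> \<subseteq> \<D>" and 0: "\<omega> 0 = 0"
  shows "cmod (taylor_coeff \<omega> 1) \<le> 1"
    and "cmod (taylor_coeff \<omega> 2) \<le> 1 - (cmod (taylor_coeff \<omega> 1))\<^sup>2"
proof -
  obtain \<psi> where \<psi>: "\<psi> holomorphic_on \<D>" "\<And>z. cmod z < 1 \<Longrightarrow> \<omega> z = z * \<psi> z"
    and d0: "deriv \<omega> 0 = \<psi> 0"
    using Schwarz3[OF hol 0] by blast
  have lt: "cmod (\<omega> z) < 1" if "cmod z < 1" for z
    using maps that by (auto simp: image_subset_iff)
  note Schwarz = Schwarz_Lemma[OF hol 0 lt, of 0, simplified]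
  have W: "fps_expansion \<omega> 0 = fps_X * fps_expansion \<psi> 0"
    using \<psi> by (intro fps_expansion_times_z) auto
  have c2: "taylor_coeff \<omega> 2 = deriv \<psi> 0"
    unfolding W using taylor_coeff_1[of \<psi>] by simp
  show "cmod (taylor_coeff \<omega> 1) \<le> 1"
    unfolding taylor_coeff_1 by (rule Schwarz(2))
  show "cmod (taylor_coeff \<omega> 2) \<le> 1 - (cmod (taylor_coeff \<omega> 1))\<^sup>2"
  proof (cases "cmod (deriv \<omega> 0) = 1")
    \<comment> \<open>in this case \<open>\<omega>\<close> is a rotation\<close>
    case True
    then obtain \<alpha> where \<alpha>: "\<And>z. cmod z < 1 \<Longrightarrow> \<omega> z = \<alpha> * z"
      using Schwarz(3) by blast
    have "fps_expansion \<omega> 0 = fps_X * fps_expansion (\<lambda>_. \<alpha>) 0"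
      using \<alpha> by (intro fps_expansion_times_z) (auto simp: mult.commute)
    also have "fps_expansion (\<lambda>_. \<alpha>) 0 = fps_const \<alpha>"
      by (intro fps_expansion_eqI) auto
    finally have "taylor_coeff \<omega> 2 = 0" by simp
    with True show ?thesis unfolding taylor_coeff_1 by simp
  next
    case False
    have "cmod (\<psi> z) < 1" if "z \<in> \<D>" for z
    proof (cases "z = 0")
      case True
      with False Schwarz(2) show ?thesis by (simp add: d0)
    next
      case z: False
      have "cmod (\<omega> z) \<noteq> cmod z"
      proof
        assume "cmod (\<omega> z) = cmod z"
        then obtain \<alpha> where \<alpha>: "\<And>z. cmod z < 1 \<Longrightarrow> \<omega> z = \<alpha> * z" "cmod \<alpha> = 1"
          using Schwarz(3) z \<open>z \<in> \<D>\<close> by auto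
        have "((\<lambda>z. \<alpha> * z) has_field_derivative \<alpha>) (at 0)"
          by (auto intro!: derivative_eq_intros)
        then have "(\<omega> has_field_derivative \<alpha>) (at 0)"
          by (rule has_field_derivative_transform_within_open[where S = \<D>]) (auto simp: \<alpha>)
        then show False
          using False \<alpha>(2) DERIV_imp_deriv by blast
      qed
      moreover have "cmod (\<omega> z) \<le> cmod z"
        using Schwarz_Lemma(1)[OF hol 0 lt] that by simp
      ultimately have "cmod z * cmod (\<psi> z) < cmod z * 1"
        using \<psi>(2)[of z] that by (simp add: norm_mult)
      then show ?thesis
        using z by simp
    qed
    then show ?thesis
      unfolding c2 taylor_coeff_1 d0 by (rule Schwarz_Pick_at_0[OF \<psi>(1)])
  qed
qed

text \<open>The extremal functions of the Schwarz--Pick inequality, multiplied by \<open>z\<close>, have the form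
  \<open>z (b z + c\<^sub>1) / (1 + cnj c\<^sub>1 b z)\<close>. Their second coefficient is \<open>b (1 - |c\<^sub>1|\<^sup>2)\<close>, which fills the
  admissible disc as \<open>b\<close> runs through the closed unit disc. For \<open>|c\<^sub>1| = 1\<close> only the rotation
  \<open>z \<mapsto> c\<^sub>1 z\<close> remains.\<close>

lemma Schwarz_coeffs_exist:
  assumes c1: "cmod c1 \<le> 1" and c2: "cmod c2 \<le> 1 - (cmod c1)\<^sup>2"
  obtains \<omega> where "\<omega> holomorphic_on \<D>" "\<omega> ` \<D> \<subseteq> \<D>" "\<omega> 0 = 0"
    "taylor_coeff \<omega> 1 = c1" "taylor_coeff \<omega> 2 = c2"
proof -
  have "\<exists>\<psi>. \<psi> holomorphic_on \<D> \<and> (\<forall>z\<in>\<D>. cmod (\<psi> z) \<le> 1) \<and> \<psi> 0 = c1 \<and> deriv \<psi> 0 = c2"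
  proof (cases "cmod c1 = 1")
    case True
    with c2 have "c2 = 0" by simp
    with c1 show ?thesis
      by (intro exI[of _ "\<lambda>_. c1"]) auto
  next
    case False
    with c1 have lt: "cmod (- c1) < 1" by simp
    then have pos: "0 < 1 - (cmod c1)\<^sup>2"
      by (simp add: power_less_one_iff abs_square_less_1)
    define b where "b = c2 / of_real (1 - (cmod c1)\<^sup>2)"
    have "cmod b = cmod c2 / (1 - (cmod c1)\<^sup>2)"
      unfolding b_def using pos by (simp only: norm_divide norm_of_real abs_of_pos)
    then have b: "cmod b \<le> 1"
      using c2 pos by (simp add: divide_le_eq_1)
    have bz: "cmod (b * z) < 1" if "cmod z < 1" for z
      using mult_right_mono[OF b norm_ge_zero[of z]] that by (simp add: norm_mult)
    define \<psi> where "\<psi> = Moebius_function 0 (- c1) \<circ> (\<lambda>z. b * z)"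
    have "\<psi> holomorphic_on \<D>"
      unfolding \<psi>_def
      by (rule holomorphic_on_compose_gen[OF _ Moebius_function_holomorphic[OF lt]])
         (use bz in \<open>auto intro!: holomorphic_intros\<close>)
    moreover have "cmod (\<psi> z) \<le> 1" if "z \<in> \<D>" for z
      using Moebius_function_norm_lt_1[OF lt bz] that by (simp add: \<psi>_def less_imp_le)
    moreover have "\<psi> 0 = c1"
      by (simp add: \<psi>_def Moebius_function_of_zero)
    moreover have "(\<psi> has_field_derivative of_real (1 - (cmod c1)\<^sup>2) * b) (at 0)"
      unfolding \<psi>_def
      using Moebius_function_has_field_derivative[of "- c1" "b * 0"]
      by (intro DERIV_chain) (auto intro!: derivative_eq_intros)
    then have "deriv \<psi> 0 = c2"
      using pos by (simp only: DERIV_imp_deriv b_def) (simp add: complex_eq_iff)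
    ultimately show ?thesis by blast
  qed
  then obtain \<psi> where \<psi>: "\<psi> holomorphic_on \<D>" "\<And>z. z \<in> \<D> \<Longrightarrow> cmod (\<psi> z) \<le> 1"
    "\<psi> 0 = c1" "deriv \<psi> 0 = c2"
    by blast
  define \<omega> where "\<omega> z = z * \<psi> z" for z
  have W: "fps_expansion \<omega> 0 = fps_X * fps_expansion \<psi> 0"
    by (intro fps_expansion_times_z \<psi>) (simp add: \<omega>_def)
  show thesis
  proof
    show "\<omega> holomorphic_on \<D>"
      unfolding \<omega>_def by (intro holomorphic_intros \<psi>)
    have "cmod (\<omega> z) < 1" if "z \<in> \<D>" for z
      using mult_left_mono[OF \<psi>(2)[OF that] norm_ge_zero[of z]] that
      by (simp add: \<omega>_def norm_mult)
    then show "\<omega> ` \<D> \<subseteq> \<D>" by auto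
    show "\<omega> 0 = 0" by (simp add: \<omega>_def)
    show "taylor_coeff \<omega> 1 = c1"
      unfolding W using \<psi>(3) by (simp add: fps_expansion_def)
    show "taylor_coeff \<omega> 2 = c2"
      unfolding W using taylor_coeff_1[of \<psi>] \<psi>(4) by simp
  qed
qed

section \<open>Coefficients of the inverse function\<close>

lemma fps_compose_nth_1_2_3:
  fixes P W :: "complex fps"
  assumes "fps_nth W 0 = 0"
  shows "fps_nth (P oo W) 0 = fps_nth P 0"
    and "fps_nth (P oo W) 1 = fps_nth P 1 * fps_nth W 1"
    and "fps_nth (P oo W) 2 = fps_nth P 1 * fps_nth W 2 + fps_nth P 2 * (fps_nth W 1)\<^sup>2"
    and "fps_nth (P oo W) 3 = fps_nth P 1 * fps_nth W 3
           + 2 * fps_nth P 2 * fps_nth W 1 * fps_nth W 2 + fps_nth P 3 * (fps_nth W 1) ^ 3"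
  using assms
  by (simp_all add: fps_compose_nth eval_nat_numeral fps_mult_nth algebra_simps)

text \<open>The coefficients at \<open>X\<^sup>2\<close> and \<open>X\<^sup>3\<close> of the identity \<open>F \<circ> G = X\<close> of power series can be solved
  for those of \<open>G\<close>, since \<open>F\<close> and \<open>G\<close> start with \<open>X\<close>.\<close>

lemma inverse_coeffs:
  assumes f: "f \<in> class_A" and g: "inverse_near_0 f g"
  shows "taylor_coeff g 2 = - taylor_coeff f 2"
    and "taylor_coeff g 3 = 2 * (taylor_coeff f 2)\<^sup>2 - taylor_coeff f 3"
proof -
  define F G where "F = fps_expansion f 0" and "G = fps_expansion g 0"
  have F: "f has_fps_expansion F"
    unfolding F_def using f by (intro has_fps_expansion_disc) (auto simp: class_A_def)
  have G: "g has_fps_expansion G"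
    unfolding G_def using g
    by (intro analytic_at_imp_has_fps_expansion_0) (auto simp: inverse_near_0_def)
  have F1: "fps_nth F 1 = 1"
    using f by (simp add: F_def taylor_coeff_1[simplified] class_A_def)
  have G0: "fps_nth G 0 = 0"
    using g has_fps_expansion_imp_0_eq_fps_nth_0[OF G] by (simp add: inverse_near_0_def)
  have "(f \<circ> g) has_fps_expansion (F oo G)"
    by (rule has_fps_expansion_compose[OF F G G0])
  moreover have "\<forall>\<^sub>F z in nhds 0. (f \<circ> g) z = z"
    using g by (simp add: inverse_near_0_def)
  ultimately have "(\<lambda>z. z) has_fps_expansion (F oo G)"
    by (rule has_fps_expansion_transform)
  then have X: "F oo G = fps_X"
    using has_fps_expansion_fps_X fps_expansion_unique_complex by blast
  have G1: "fps_nth G 1 = 1"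
    using fps_compose_nth_1_2_3(2)[OF G0, of F] by (simp add: X F1[simplified])
  have 2: "fps_nth G 2 + fps_nth F 2 = 0"
    using fps_compose_nth_1_2_3(3)[OF G0, of F] F1 G1 by (simp add: X)
  then show G2: "taylor_coeff g 2 = - taylor_coeff f 2"
    unfolding F_def G_def by (simp add: add_eq_0_iff2)
  have "fps_nth G 3 + 2 * fps_nth F 2 * fps_nth G 2 + fps_nth F 3 = 0"
    using fps_compose_nth_1_2_3(4)[OF G0, of F] F1 G1 by (simp add: X)
  then show "taylor_coeff g 3 = 2 * (taylor_coeff f 2)\<^sup>2 - taylor_coeff f 3"
    using G2 unfolding F_def[symmetric] G_def[symmetric]
    by (simp add: power2_eq_square) algebra
qed

text \<open>The power series identity \<open>X F'' = (P \<circ> W - 1) F'\<close> determines \<open>a\<^sub>2\<close> and \<open>a\<^sub>3\<close> from its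
  coefficients at \<open>X\<close> and \<open>X\<^sup>2\<close>.\<close>

lemma coeffs_of_subordinate:
  assumes f: "f \<in> class_A" and f': "\<And>z. z \<in> \<D> \<Longrightarrow> deriv f z \<noteq> 0"
    and \<Phi>: "\<Phi> holomorphic_on \<D>" "\<Phi> 0 = 1"
    and \<omega>: "\<omega> holomorphic_on \<D>" "\<omega> 0 = 0"
    and eq: "\<And>z. z \<in> \<D> \<Longrightarrow> 1 + z * deriv (deriv f) z / deriv f z = \<Phi> (\<omega> z)"
  shows "2 * taylor_coeff f 2 = taylor_coeff \<Phi> 1 * taylor_coeff \<omega> 1"
    and "6 * taylor_coeff f 3 = taylor_coeff \<Phi> 1 * taylor_coeff \<omega> 2
           + (taylor_coeff \<Phi> 2 + (taylor_coeff \<Phi> 1)\<^sup>2) * (taylor_coeff \<omega> 1)\<^sup>2"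
proof -
  define F P W where "F = fps_expansion f 0" and "P = fps_expansion \<Phi> 0"
    and "W = fps_expansion \<omega> 0"
  have F: "f has_fps_expansion F"
    unfolding F_def using f by (intro has_fps_expansion_disc) (auto simp: class_A_def)
  have P: "\<Phi> has_fps_expansion P"
    unfolding P_def using \<Phi> by (intro has_fps_expansion_disc)
  have W: "\<omega> has_fps_expansion W"
    unfolding W_def using \<omega> by (intro has_fps_expansion_disc)
  have F1: "fps_nth F 1 = 1"
    using f by (simp add: F_def taylor_coeff_1[simplified] class_A_def)
  have P0: "fps_nth P 0 = 1"
    using \<Phi> has_fps_expansion_imp_0_eq_fps_nth_0[OF P] by simp
  have W0: "fps_nth W 0 = 0"
    using \<omega> has_fps_expansion_imp_0_eq_fps_nth_0[OF W] by simp
  define Q where "Q = (P oo W) - 1"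
  have "(\<Phi> \<circ> \<omega>) has_fps_expansion (P oo W)"
    by (rule has_fps_expansion_compose[OF P W W0])
  then have "(\<lambda>z. ((\<Phi> \<circ> \<omega>) z - 1) * deriv f z) has_fps_expansion Q * fps_deriv F"
    unfolding Q_def
    by (rule has_fps_expansion_mult[OF has_fps_expansion_diff[OF _ has_fps_expansion_1]
          has_fps_expansion_deriv[OF F]])
  moreover have "\<forall>\<^sub>F z in nhds 0. ((\<Phi> \<circ> \<omega>) z - 1) * deriv f z = z * deriv (deriv f) z"
    using eventually_disc_0
  proof eventually_elim
    case (elim z)
    then show ?case
      using eq[OF elim, symmetric] f'[OF elim] by simp
  qed
  ultimately have "(\<lambda>z. z * deriv (deriv f) z) has_fps_expansion Q * fps_deriv F"
    by (rule has_fps_expansion_transform)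
  moreover have "(\<lambda>z. z * deriv (deriv f) z) has_fps_expansion fps_X * fps_deriv (fps_deriv F)"
    by (intro fps_expansion_intros F)
  ultimately have ode: "fps_X * fps_deriv (fps_deriv F) = Q * fps_deriv F"
    using fps_expansion_unique_complex by blast
  have Q: "fps_nth Q 0 = 0" "fps_nth Q 1 = fps_nth P 1 * fps_nth W 1"
    "fps_nth Q 2 = fps_nth P 1 * fps_nth W 2 + fps_nth P 2 * (fps_nth W 1)\<^sup>2"
    using fps_compose_nth_1_2_3[OF W0, of P] by (simp_all add: Q_def P0)
  have "fps_nth (fps_X * fps_deriv (fps_deriv F)) 1 = 2 * fps_nth F 2"
    by (simp add: numeral_2_eq_2)
  moreover have "fps_nth (Q * fps_deriv F) 1 = fps_nth Q 1"
    using Q(1) F1 by (simp add: fps_mult_nth)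
  ultimately show 2: "2 * taylor_coeff f 2 = taylor_coeff \<Phi> 1 * taylor_coeff \<omega> 1"
    unfolding F_def[symmetric] P_def[symmetric] W_def[symmetric] using ode Q(2) by simp
  have "fps_nth (fps_X * fps_deriv (fps_deriv F)) 2 = 6 * fps_nth F 3"
    by (simp add: eval_nat_numeral)
  moreover have "fps_nth (Q * fps_deriv F) 2 = fps_nth Q 1 * (2 * fps_nth F 2) + fps_nth Q 2"
    using Q(1) F1 by (simp add: fps_mult_nth eval_nat_numeral)
  ultimately have "6 * fps_nth F 3 = fps_nth Q 1 * (2 * fps_nth F 2) + fps_nth Q 2"
    using ode by simp
  then show "6 * taylor_coeff f 3 = taylor_coeff \<Phi> 1 * taylor_coeff \<omega> 2
           + (taylor_coeff \<Phi> 2 + (taylor_coeff \<Phi> 1)\<^sup>2) * (taylor_coeff \<omega> 1)\<^sup>2"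
    using 2 unfolding F_def[symmetric] P_def[symmetric] W_def[symmetric] Q(2,3)
    by (simp add: power2_eq_square algebra_simps)
qed

lemma inverse_coeffs_of_subordinate:
  assumes "f \<in> class_A" "\<And>z. z \<in> \<D> \<Longrightarrow> deriv f z \<noteq> 0"
    and "\<Phi> holomorphic_on \<D>" "\<Phi> 0 = 1"
    and "\<omega> holomorphic_on \<D>" "\<omega> 0 = 0"
    and "\<And>z. z \<in> \<D> \<Longrightarrow> 1 + z * deriv (deriv f) z / deriv f z = \<Phi> (\<omega> z)"
    and "inverse_near_0 f g"
  shows "taylor_coeff g 2 = - (taylor_coeff \<Phi> 1 * taylor_coeff \<omega> 1) / 2"
    and "taylor_coeff g 3 =
      ((2 * (taylor_coeff \<Phi> 1)\<^sup>2 - taylor_coeff \<Phi> 2) * (taylor_coeff \<omega> 1)\<^sup>2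
        - taylor_coeff \<Phi> 1 * taylor_coeff \<omega> 2) / 6"
proof -
  note a = coeffs_of_subordinate[OF assms(1-7)] and A = inverse_coeffs[OF assms(1,8)]
  have a2: "taylor_coeff f 2 = taylor_coeff \<Phi> 1 * taylor_coeff \<omega> 1 / 2"
    using a(1) by (simp add: field_simps)
  show "taylor_coeff g 2 = - (taylor_coeff \<Phi> 1 * taylor_coeff \<omega> 1) / 2"
    unfolding A a2 by simp
  have "6 * taylor_coeff g 3 = 12 * (taylor_coeff f 2)\<^sup>2 - 6 * taylor_coeff f 3"
    unfolding A by simp
  also have "\<dots> = (2 * (taylor_coeff \<Phi> 1)\<^sup>2 - taylor_coeff \<Phi> 2) * (taylor_coeff \<omega> 1)\<^sup>2
        - taylor_coeff \<Phi> 1 * taylor_coeff \<omega> 2"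
    using a(2) unfolding a2 by (simp add: power2_eq_square algebra_simps)
  finally show "taylor_coeff g 3 =
      ((2 * (taylor_coeff \<Phi> 1)\<^sup>2 - taylor_coeff \<Phi> 2) * (taylor_coeff \<omega> 1)\<^sup>2
        - taylor_coeff \<Phi> 1 * taylor_coeff \<omega> 2) / 6"
    by (simp only: eq_divide_eq mult.commute[of _ 6]) simp
qed

section \<open>Functions with prescribed Schwarz function\<close>

lemma disc_primitive:
  fixes a :: complex
  assumes "h holomorphic_on \<D>"
  obtains H where "H 0 = a" "\<And>z. z \<in> \<D> \<Longrightarrow> (H has_field_derivative h z) (at z)"
proof -
  obtain g where g: "\<And>z. z \<in> \<D> \<Longrightarrow> (g has_field_derivative h z) (at z within \<D>)"
    using holomorphic_convex_primitive'[OF convex_ball open_ball assms] by blast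
  show thesis
  proof (rule that[of "\<lambda>z. g z + (a - g 0)"])
    show "g 0 + (a - g 0) = a" by simp
    show "((\<lambda>z. g z + (a - g 0)) has_field_derivative h z) (at z)" if "z \<in> \<D>" for z
      using g[OF that] that by (auto intro!: derivative_eq_intros simp: at_within_open[OF that])
  qed
qed

text \<open>Since \<open>\<Phi> \<circ> \<omega> - 1\<close> vanishes at the origin it equals \<open>z h z\<close>, and the solution is
  \<open>f' = exp H\<close> with \<open>H' = h\<close>; the exponential makes \<open>f'\<close> free of zeros.\<close>

lemma Ma_Minda_convex_of_Schwarz:
  assumes \<Phi>: "\<Phi> holomorphic_on \<D>" "\<Phi> 0 = 1"
    and \<omega>: "\<omega> holomorphic_on \<D>" "\<omega> ` \<D> \<subseteq> \<D>" "\<omega> 0 = 0"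
  obtains f where "f \<in> Ma_Minda_convex \<Phi>"
    "\<And>z. z \<in> \<D> \<Longrightarrow> 1 + z * deriv (deriv f) z / deriv f z = \<Phi> (\<omega> z)"
proof -
  have hol: "(\<lambda>z. \<Phi> (\<omega> z)) holomorphic_on \<D>"
    using holomorphic_on_compose_gen[OF \<omega>(1) \<Phi>(1) \<omega>(2)] by (simp add: o_def)
  obtain h where h: "h holomorphic_on \<D>" "\<And>z. cmod z < 1 \<Longrightarrow> \<Phi> (\<omega> z) - 1 = z * h z"
  proof (rule Schwarz3)
    show "(\<lambda>z. \<Phi> (\<omega> z) - 1) holomorphic_on \<D>"
      using hol by (intro holomorphic_intros)
    show "\<Phi> (\<omega> 0) - 1 = 0"
      by (simp add: \<omega>(3) \<Phi>(2))
  qed (use that in blast)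
  obtain H where H: "H 0 = 0" "\<And>z. z \<in> \<D> \<Longrightarrow> (H has_field_derivative h z) (at z)"
    using disc_primitive[OF h(1)] by blast
  have "H holomorphic_on \<D>"
    using H(2) holomorphic_on_open[OF open_ball] by blast
  then have "(\<lambda>z. exp (H z)) holomorphic_on \<D>"
    by (intro holomorphic_intros)
  then obtain f where f: "f 0 = 0" "\<And>z. z \<in> \<D> \<Longrightarrow> (f has_field_derivative exp (H z)) (at z)"
    using disc_primitive by blast
  have f': "deriv f z = exp (H z)" if "z \<in> \<D>" for z
    using f(2)[OF that] by (rule DERIV_imp_deriv)
  have f'': "deriv (deriv f) z = exp (H z) * h z" if "z \<in> \<D>" for z
  proof (rule DERIV_imp_deriv)
    have "((\<lambda>z. exp (H z)) has_field_derivative exp (H z) * h z) (at z)"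
      using H(2)[OF that] by (auto intro!: derivative_eq_intros)
    then show "(deriv f has_field_derivative exp (H z) * h z) (at z)"
      by (rule has_field_derivative_transform_within_open[where S = \<D>])
         (use that f' in auto)
  qed
  have eq: "1 + z * deriv (deriv f) z / deriv f z = \<Phi> (\<omega> z)" if "z \<in> \<D>" for z
    using h(2)[of z] that by (simp add: f' f'' diff_eq_eq)
  have "f holomorphic_on \<D>"
    using f(2) holomorphic_on_open[OF open_ball] by blast
  then have "f \<in> class_A"
    using f(1) f'[of 0] H(1) by (simp add: class_A_def)
  moreover have "(\<lambda>z. 1 + z * deriv (deriv f) z / deriv f z) \<prec> \<Phi>"
    unfolding subordinate_def
  proof (intro conjI exI[of _ \<omega>] ballI)
    show "(\<lambda>z. 1 + z * deriv (deriv f) z / deriv f z) holomorphic_on \<D>"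
      using hol by (rule holomorphic_transform) (simp add: eq)
  qed (use \<Phi> \<omega> eq in auto)
  ultimately have "f \<in> Ma_Minda_convex \<Phi>"
    by (simp add: Ma_Minda_convex_def f')
  then show thesis using that eq by blast
qed

section \<open>The coefficient body\<close>

text \<open>The next two lemmas describe the pairs \<open>(A\<^sub>2, A\<^sub>3)\<close> exactly, so that bounds and their
  sharpness become the same question about \<open>c\<^sub>1\<close> and \<open>c\<^sub>2\<close>.\<close>

lemma inverse_coeffs_Ma_Minda_convex:
  assumes \<Phi>: "\<Phi> holomorphic_on \<D>" "\<Phi> 0 = 1"
    and f: "f \<in> Ma_Minda_convex \<Phi>" and g: "inverse_near_0 f g"
  obtains c1 c2 where "cmod c1 \<le> 1" "cmod c2 \<le> 1 - (cmod c1)\<^sup>2"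
    "taylor_coeff g 2 = - (taylor_coeff \<Phi> 1 * c1) / 2"
    "taylor_coeff g 3 =
      ((2 * (taylor_coeff \<Phi> 1)\<^sup>2 - taylor_coeff \<Phi> 2) * c1\<^sup>2 - taylor_coeff \<Phi> 1 * c2) / 6"
proof -
  obtain \<omega> where \<omega>: "\<omega> holomorphic_on \<D>" "\<omega> ` \<D> \<subseteq> \<D>" "\<omega> 0 = 0"
    and eq: "\<And>z. z \<in> \<D> \<Longrightarrow> 1 + z * deriv (deriv f) z / deriv f z = \<Phi> (\<omega> z)"
    using f by (auto simp: Ma_Minda_convex_def subordinate_def)
  have "f \<in> class_A" "\<And>z. z \<in> \<D> \<Longrightarrow> deriv f z \<noteq> 0"
    using f by (auto simp: Ma_Minda_convex_def)
  note A = inverse_coeffs_of_subordinate[OF this \<Phi> \<omega>(1,3) eq g]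
  show thesis
    using that[OF Schwarz_coeffs_bound[OF \<omega>] A] .
qed

lemma inverse_coeffs_attained:
  assumes \<Phi>: "\<Phi> holomorphic_on \<D>" "\<Phi> 0 = 1"
    and c: "cmod c1 \<le> 1" "cmod c2 \<le> 1 - (cmod c1)\<^sup>2"
  obtains f g where "f \<in> Ma_Minda_convex \<Phi>" "inverse_near_0 f g"
    "taylor_coeff g 2 = - (taylor_coeff \<Phi> 1 * c1) / 2"
    "taylor_coeff g 3 =
      ((2 * (taylor_coeff \<Phi> 1)\<^sup>2 - taylor_coeff \<Phi> 2) * c1\<^sup>2 - taylor_coeff \<Phi> 1 * c2) / 6"
proof -
  obtain \<omega> where \<omega>: "\<omega> holomorphic_on \<D>" "\<omega> ` \<D> \<subseteq> \<D>" "\<omega> 0 = 0"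
    and cs: "taylor_coeff \<omega> 1 = c1" "taylor_coeff \<omega> 2 = c2"
    using Schwarz_coeffs_exist[OF c] by blast
  obtain f where f: "f \<in> Ma_Minda_convex \<Phi>"
    and eq: "\<And>z. z \<in> \<D> \<Longrightarrow> 1 + z * deriv (deriv f) z / deriv f z = \<Phi> (\<omega> z)"
    using Ma_Minda_convex_of_Schwarz[OF \<Phi> \<omega>] by blast
  have fA: "f \<in> class_A" "\<And>z. z \<in> \<D> \<Longrightarrow> deriv f z \<noteq> 0"
    using f by (auto simp: Ma_Minda_convex_def)
  obtain g where g: "inverse_near_0 f g"
    using inverse_near_0_exists[OF fA(1)] by blast
  note A = inverse_coeffs_of_subordinate[OF fA \<Phi> \<omega>(1,3) eq g, unfolded cs]
  show thesis
    using that[OF f g A] .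
qed

section \<open>Optimisation over the modulus of the first coefficient\<close>

lemma optimum_upper:
  fixes B m x :: real
  assumes B: "0 < B" and x: "0 \<le> x" "x \<le> 1"
  shows "m * x\<^sup>2 + B * (1 - x\<^sup>2) - 3 * B * x \<le> (if m \<ge> 4 * B then m - 3 * B else B)"
proof (cases "m \<ge> 4 * B")
  case True
  have "3 * B * 1 \<le> (m - B) * (1 + x)"
    using True B x by (intro mult_mono) auto
  then have "0 \<le> (1 - x) * ((m - B) * (1 + x) - 3 * B)"
    using x by simp
  also have "\<dots> = (m - 3 * B) - (m * x\<^sup>2 + B * (1 - x\<^sup>2) - 3 * B * x)"
    by (simp add: power2_eq_square algebra_simps)
  finally show ?thesis using True by simp
next
  case False
  have "(m - B) * x\<^sup>2 \<le> 3 * B * x\<^sup>2"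
    using False by (intro mult_right_mono) auto
  also have "\<dots> \<le> 3 * B * x"
    using B x by (simp add: power2_eq_square mult_left_le)
  finally show ?thesis
    using False by (simp add: algebra_simps)
qed

text \<open>For \<open>2 m \<le> B\<close> the vertex of the parabola is not to the left of \<open>1\<close>.\<close>

lemma optimum_lower_endpoint:
  fixes B m x :: real
  assumes x: "0 \<le> x" "x \<le> 1" and "0 \<le> m" "0 < B" "2 * m \<le> B"
  shows "m - 3 * B \<le> m * x\<^sup>2 - B * (1 - x\<^sup>2) - 3 * B * x"
proof -
  have "(m + B) * (1 + x) \<le> (m + B) * 2"
    using assms by (intro mult_left_mono) auto
  then have "0 \<le> (1 - x) * (3 * B - (m + B) * (1 + x))"
    using assms by simp
  also have "\<dots> = (m * x\<^sup>2 - B * (1 - x\<^sup>2) - 3 * B * x) - (m - 3 * B)"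
    by (simp add: power2_eq_square algebra_simps)
  finally show ?thesis by simp
qed

text \<open>At the kink \<open>s\<close> the lower estimate of \<open>6 |A\<^sub>3|\<close> changes from \<open>0\<close> to a parabola, whose vertex
  is not to the right of \<open>s\<close> exactly when \<open>5 B \<le> 4 m\<close>.\<close>

lemma optimum_lower_kink:
  fixes B m x r :: real
  defines "s \<equiv> sqrt (B / (B + m))"
  assumes B: "0 < B" and m: "5 * B \<le> 4 * m" and x: "0 \<le> x"
    and r: "0 \<le> r" "m * x\<^sup>2 - B * (1 - x\<^sup>2) \<le> r"
  shows "- 3 * B * s \<le> r - 3 * B * x"
proof (cases "x \<le> s")
  case True
  then have "3 * B * x \<le> 3 * B * s"
    using B by (intro mult_left_mono) auto
  then show ?thesis
    using r(1) by linarith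
next
  case False
  have s2: "s\<^sup>2 * (m + B) = B" and s0: "0 \<le> s"
    using B m by (simp_all add: s_def add.commute)
  have "(3 * B)\<^sup>2 \<le> 4 * (B * (m + B))"
    using mult_left_mono[OF m, of B] B by (simp add: power2_eq_square algebra_simps)
  also have "\<dots> = 4 * ((s\<^sup>2 * (m + B)) * (m + B))"
    by (simp only: s2)
  also have "\<dots> = (2 * s * (m + B))\<^sup>2"
    by (simp add: power2_eq_square)
  finally have "3 * B \<le> 2 * s * (m + B)"
    by (rule power2_le_imp_le) (use s0 B m in auto)
  also have "\<dots> \<le> (x + s) * (m + B)"
    using False B m by (intro mult_right_mono) auto
  finally have "0 \<le> (x - s) * ((x + s) * (m + B) - 3 * B)"
    using False by simp
  also have "\<dots> = (m + B) * x\<^sup>2 - s\<^sup>2 * (m + B) - 3 * B * (x - s)"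
    by (simp add: power2_eq_square algebra_simps)
  also have "\<dots> = m * x\<^sup>2 - B * (1 - x\<^sup>2) - 3 * B * x + 3 * B * s"
    unfolding s2 by (simp add: algebra_simps)
  finally show ?thesis using r(2) by simp
qed

lemma optimum_lower_vertex:
  fixes B m x :: real
  assumes "0 < m + B"
  shows "- B - 9 * B\<^sup>2 / (4 * (m + B)) \<le> m * x\<^sup>2 - B * (1 - x\<^sup>2) - 3 * B * x"
proof -
  define d t where "d = m + B" and "t = 3 * B / (2 * d)"
  have d: "0 < d"
    using assms by (simp add: d_def)
  then have t: "3 * B = 2 * d * t" and t2: "9 * B\<^sup>2 / (4 * d) = d * t\<^sup>2"
    by (simp_all add: t_def power2_eq_square)
  have "0 \<le> d * (x - t)\<^sup>2"
    using d by simp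
  also have "\<dots> = d * x\<^sup>2 - (2 * d * t) * x + d * t\<^sup>2"
    by (simp add: power2_eq_square algebra_simps)
  also have "\<dots> = d * x\<^sup>2 - 3 * B * x + 9 * B\<^sup>2 / (4 * d)"
    unfolding t t2 ..
  also have "d * x\<^sup>2 = m * x\<^sup>2 - B * (1 - x\<^sup>2) + B"
    by (simp add: d_def algebra_simps)
  finally show ?thesis
    by (simp add: d_def)
qed

text \<open>In terms of \<open>m\<close>, and cleared of the denominator \<open>6\<close>, the bounds match the optima above.\<close>

lemma upper_bound_eq:
  "6 * upper_bound B1 B2 = (let m = cmod (2 * of_real B1 ^ 2 - B2) in
     if m \<ge> 4 * B1 then m - 3 * B1 else B1)"
  by (simp add: upper_bound_def Let_def)

lemma lower_bound_eq:
  assumes "B1 > 0"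
  shows "6 * lower_bound B1 B2 = (let m = cmod (2 * of_real B1 ^ 2 - B2) in
     if 2 * m \<le> B1 then m - 3 * B1
     else if 5 * B1 \<le> 4 * m then - 3 * B1 * sqrt (B1 / (B1 + m))
     else - B1 - 9 * B1\<^sup>2 / (4 * (m + B1)))"
proof -
  define m where "m = cmod (2 * of_real B1 ^ 2 - B2)"
  have "4 * of_real B1 ^ 2 - 2 * B2 = 2 * (2 * of_real B1 ^ 2 - B2)"
    and "8 * of_real B1 ^ 2 - 4 * B2 = 4 * (2 * of_real B1 ^ 2 - B2)"
    by simp_all
  then have 2: "cmod (4 * of_real B1 ^ 2 - 2 * B2) = 2 * m"
    and 4: "cmod (8 * of_real B1 ^ 2 - 4 * B2) = 4 * m"
    by (simp_all only: norm_mult norm_numeral m_def)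
  have "0 < m + B1"
    using assms by (simp add: m_def add_nonneg_pos)
  then have "6 * (- B1 / 6 - 3 * B1\<^sup>2 / (8 * m + 8 * B1)) = - B1 - 9 * B1\<^sup>2 / (4 * (m + B1))"
    by (simp add: field_simps)
  then show ?thesis
    unfolding lower_bound_def 2 4 m_def[symmetric] Let_def by auto
qed

section \<open>The sharp bounds\<close>

theorem theorem2p3:
  fixes \<Phi> :: "complex \<Rightarrow> complex" and B1 :: real and B2 :: complex
  assumes "\<Phi> holomorphic_on \<D>"
    and "inj_on \<Phi> \<D>"
    and "\<Phi> 0 = 1"
    and "symmetric_real_axis (\<Phi> ` \<D>)"
    and "starlike_wrt (\<Phi> 0) (\<Phi> ` \<D>)"
    and "taylor_coeff \<Phi> 1 = of_real B1"
    and "B1 > 0"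
    and "taylor_coeff \<Phi> 2 = B2"
  shows "(\<forall>f\<in>Ma_Minda_convex \<Phi>. \<forall>g. inverse_near_0 f g \<longrightarrow>
            cmod (taylor_coeff g 3) - cmod (taylor_coeff g 2) \<le> upper_bound B1 B2 \<and>
            cmod (taylor_coeff g 3) - cmod (taylor_coeff g 2) \<ge> lower_bound B1 B2) \<and>
         (\<exists>f\<in>Ma_Minda_convex \<Phi>. \<exists>g. inverse_near_0 f g \<and>
            cmod (taylor_coeff g 3) - cmod (taylor_coeff g 2) = upper_bound B1 B2) \<and>
         (\<exists>f\<in>Ma_Minda_convex \<Phi>. \<exists>g. inverse_near_0 f g \<and>
            cmod (taylor_coeff g 3) - cmod (taylor_coeff g 2) = lower_bound B1 B2)"
proof -
  note \<Phi> = assms(1,3) and P1 = assms(6) and B = assms(7) and P2 = assms(8)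
  define M m where "M = 2 * of_real B1 ^ 2 - B2" and "m = cmod M"
  have m0: "0 \<le> m" by (simp add: m_def)
  note upper = upper_bound_eq[of B1 B2, folded M_def, folded m_def, unfolded Let_def]
  note lower = lower_bound_eq[OF B, of B2, folded M_def, folded m_def, unfolded Let_def]
  have bounds: "cmod (taylor_coeff g 3) - cmod (taylor_coeff g 2) \<le> upper_bound B1 B2 \<and>
        cmod (taylor_coeff g 3) - cmod (taylor_coeff g 2) \<ge> lower_bound B1 B2"
    if f: "f \<in> Ma_Minda_convex \<Phi>" and g: "inverse_near_0 f g" for f g
  proof -
    obtain c1 c2 where c: "cmod c1 \<le> 1" "cmod c2 \<le> 1 - (cmod c1)\<^sup>2"
      and A2: "taylor_coeff g 2 = - (of_real B1 * c1) / 2"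
      and A3: "taylor_coeff g 3 = (M * c1\<^sup>2 - of_real B1 * c2) / 6"
      using inverse_coeffs_Ma_Minda_convex[OF \<Phi> f g] unfolding P1 P2 M_def by metis
    define x r where "x = cmod c1" and "r = cmod (M * c1\<^sup>2 - of_real B1 * c2)"
    have x: "0 \<le> x" "x \<le> 1" using c by (auto simp: x_def)
    have c2: "B1 * cmod c2 \<le> B1 * (1 - x\<^sup>2)"
      using B c(2) by (simp add: x_def)
    have n: "cmod (M * c1\<^sup>2) = m * x\<^sup>2" "cmod (of_real B1 * c2) = B1 * cmod c2"
      using B by (simp_all add: norm_mult norm_power m_def x_def)
    have r_le: "r \<le> m * x\<^sup>2 + B1 * (1 - x\<^sup>2)"
      using norm_triangle_ineq4[of "M * c1\<^sup>2" "of_real B1 * c2"] c2 n by (simp add: r_def)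
    have r_ge: "m * x\<^sup>2 - B1 * (1 - x\<^sup>2) \<le> r" "0 \<le> r"
      using norm_triangle_ineq2[of "M * c1\<^sup>2" "of_real B1 * c2"] c2 n by (simp_all add: r_def)
    have val: "6 * (cmod (taylor_coeff g 3) - cmod (taylor_coeff g 2)) = r - 3 * B1 * x"
      unfolding A2 A3 using B by (simp add: norm_divide norm_mult r_def x_def)
    have "r - 3 * B1 * x \<le> 6 * upper_bound B1 B2"
      using optimum_upper[OF B x, of m] r_le unfolding upper by linarith
    moreover have "6 * lower_bound B1 B2 \<le> r - 3 * B1 * x"
      using optimum_lower_endpoint[OF x m0 B] optimum_lower_kink[OF B _ x(1) r_ge(2,1)]
        optimum_lower_vertex[of m B1 x] m0 B r_ge(1)
      unfolding lower by (auto split: if_splits)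
    ultimately show ?thesis
      using val by auto
  qed
  have attained: "\<exists>f\<in>Ma_Minda_convex \<Phi>. \<exists>g. inverse_near_0 f g \<and>
      cmod (taylor_coeff g 3) - cmod (taylor_coeff g 2) = v"
    if x: "0 \<le> x" "x \<le> 1" and b: "cmod b \<le> 1"
      and v: "6 * v = cmod (M * of_real (x\<^sup>2) - of_real (B1 * (1 - x\<^sup>2)) * b) - 3 * B1 * x"
    for x b v
  proof -
    have x2: "0 \<le> 1 - x\<^sup>2" using x by (simp add: power_le_one)
    have "cmod (of_real (1 - x\<^sup>2) * b) \<le> 1 - (cmod (of_real x))\<^sup>2"
      unfolding norm_mult norm_of_real using mult_left_mono[OF b x2] x2 by simp
    moreover have "cmod (of_real x) \<le> 1" using x by simp
    ultimately obtain f g where fg: "f \<in> Ma_Minda_convex \<Phi>" "inverse_near_0 f g"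
      and A2: "taylor_coeff g 2 = - (of_real B1 * of_real x) / 2"
      and A3: "taylor_coeff g 3 = (M * (of_real x)\<^sup>2 - of_real B1 * (of_real (1 - x\<^sup>2) * b)) / 6"
      using inverse_coeffs_attained[OF \<Phi>] unfolding P1 P2 M_def by metis
    have "6 * cmod (taylor_coeff g 3) = cmod (M * of_real (x\<^sup>2) - of_real (B1 * (1 - x\<^sup>2)) * b)"
      unfolding A3 by (simp add: norm_divide mult.assoc)
    moreover have "2 * cmod (taylor_coeff g 2) = B1 * x"
      unfolding A2 using B x by (simp add: norm_divide norm_mult)
    ultimately have "6 * (cmod (taylor_coeff g 3) - cmod (taylor_coeff g 2)) = 6 * v"
      using v by simp
    then have "cmod (taylor_coeff g 3) - cmod (taylor_coeff g 2) = v"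
      by simp
    then show ?thesis using fg by blast
  qed
  \<comment> \<open>The choice \<open>b = sgn M\<close> makes the two terms of \<open>A\<^sub>3\<close> cancel as far as possible.\<close>
  have aligned: "cmod (M * of_real (x\<^sup>2) - of_real (B1 * (1 - x\<^sup>2)) * sgn M)
      = \<bar>m * x\<^sup>2 - B1 * (1 - x\<^sup>2)\<bar>" if "M \<noteq> 0" for x
  proof -
    define \<sigma> where "\<sigma> = sgn M"
    have \<sigma>: "cmod \<sigma> = 1" and M: "M = of_real m * \<sigma>"
      using that by (simp_all add: \<sigma>_def m_def sgn_eq norm_divide)
    have "M * of_real (x\<^sup>2) - of_real (B1 * (1 - x\<^sup>2)) * \<sigma>
        = of_real (m * x\<^sup>2 - B1 * (1 - x\<^sup>2)) * \<sigma>"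
      unfolding M by (simp add: algebra_simps)
    then show ?thesis
      unfolding \<sigma>_def[symmetric] by (simp only: norm_mult norm_of_real \<sigma> mult_1_right)
  qed
  have upper_attained: "\<exists>f\<in>Ma_Minda_convex \<Phi>. \<exists>g. inverse_near_0 f g \<and>
      cmod (taylor_coeff g 3) - cmod (taylor_coeff g 2) = upper_bound B1 B2"
  proof (cases "m \<ge> 4 * B1")
    case True
    then show ?thesis
      by (intro attained[of 1 0]) (auto simp: upper m_def)
  next
    case False
    then show ?thesis
      using B by (intro attained[of 0 1]) (auto simp: upper)
  qed
  \<comment> \<open>The lower bound is attained at \<open>c\<^sub>1 = x\<close>, where \<open>x\<close> is the minimiser in each case.\<close>
  consider (endpoint) "2 * m \<le> B1" | (kink) "\<not> 2 * m \<le> B1" "5 * B1 \<le> 4 * m"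
    | (vertex) "\<not> 2 * m \<le> B1" "\<not> 5 * B1 \<le> 4 * m"
    by blast
  then have "\<exists>f\<in>Ma_Minda_convex \<Phi>. \<exists>g. inverse_near_0 f g \<and>
      cmod (taylor_coeff g 3) - cmod (taylor_coeff g 2) = lower_bound B1 B2"
  proof cases
    case endpoint
    then show ?thesis
      by (intro attained[of 1 0]) (auto simp: lower m_def)
  next
    case kink
    define s where "s = sqrt (B1 / (B1 + m))"
    have s2: "s\<^sup>2 = B1 / (B1 + m)"
      using B m0 by (simp add: s_def)
    have "M \<noteq> 0" using kink(1) B by (auto simp: m_def)
    have "m * s\<^sup>2 - B1 * (1 - s\<^sup>2) = 0"
      unfolding s2 using B m0 by (simp add: field_simps)
    moreover have "0 \<le> s" "s \<le> 1"
      using B m0 by (simp_all add: s_def)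
    ultimately show ?thesis
      using kink aligned[OF \<open>M \<noteq> 0\<close>, of s]
      by (intro attained[of s "sgn M"]) (auto simp: lower s_def norm_sgn)
  next
    case vertex
    define x where "x = 3 * B1 / (2 * (m + B1))"
    have "M \<noteq> 0" using vertex(1) B by (auto simp: m_def)
    have pos: "0 < m + B1" using B m0 by simp
    have x: "0 \<le> x" "x \<le> 1"
      using vertex(1) B pos by (simp_all add: x_def)
    have x2: "x\<^sup>2 = 9 * B1\<^sup>2 / (4 * (m + B1)\<^sup>2)"
      unfolding x_def power_divide power_mult_distrib by simp
    have "m * x\<^sup>2 - B1 * (1 - x\<^sup>2) = (m + B1) * x\<^sup>2 - B1"
      by (simp add: algebra_simps)
    also have "\<dots> = 9 * B1\<^sup>2 / (4 * (m + B1)) - B1"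
      unfolding x2 using pos by (simp add: power2_eq_square)
    finally have q: "m * x\<^sup>2 - B1 * (1 - x\<^sup>2) = 9 * B1\<^sup>2 / (4 * (m + B1)) - B1" .
    \<comment> \<open>The vertex lies to the right of the kink because \<open>4 m < 5 B\<^sub>1\<close>.\<close>
    have "B1 * (4 * (m + B1)) \<le> B1 * (9 * B1)"
      using vertex(2) B by (intro mult_left_mono) auto
    then have nonneg: "0 \<le> 9 * B1\<^sup>2 / (4 * (m + B1)) - B1"
      using pos by (simp add: le_divide_eq power2_eq_square mult.left_commute)
    have "3 * B1 * x = 2 * (9 * B1\<^sup>2 / (4 * (m + B1)))"
      unfolding x_def times_divide_eq_right mult_divide_mult_cancel_left_if
      using pos by (simp add: field_simps power2_eq_square)
    then have "6 * lower_bound B1 B2 = \<bar>m * x\<^sup>2 - B1 * (1 - x\<^sup>2)\<bar> - 3 * B1 * x"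
      unfolding q using nonneg vertex by (simp add: lower)
    then show ?thesis
      using x aligned[OF \<open>M \<noteq> 0\<close>, of x]
      by (intro attained[of x "sgn M"]) (auto simp: norm_sgn)
  qed
  then show ?thesis
    using bounds upper_attained by blast
qed

end
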